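(* Let $F$ be a normed lattice with closed unit ball $B_F$, and let $B_{F_+}=B_F\cap F_+$. The following conditions are equivalent: (i) $F$ is monotonically bounded, i.e. every directed subset of $B_{F_+}$ is order bounded in $F$; (ii) $F$ is $r$-monotonically bounded for some $r\ge 1$, i.e. there is $r\ge 1$ such that every directed subset of $B_{F_+}$ has an upper bound in $rB_F$; (iii) every directed dominable subset of $B_{F_+}$ is order bounded in $F$.
   Context: A normed lattice is a real vector lattice with a lattice (solid) norm; norm completeness is not assumed. "Directed" means upward directed. A sublattice $E$ of a vector lattice $G$ is order dense if for every $0<g\in G$ there is $e\in E$ with $0<e\le g$. The universal completion $F^u$ of $F$ is the (essentially unique) universally complete vector lattice, i.e. order (Dedekind) complete and such that every disjoint set of positive elements is order bounded, that contains $F$ as an order dense sublattice. A subset of $F$ is dominable if it is order bounded in $F^u$. *)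

theory Defs
  imports "HOL-Analysis.Analysis" "HOL-Library.Lattice_Algebras"
begin

class vector_lattice = ordered_real_vector + lattice_ab_group_add_abs

class normed_lattice = vector_lattice + real_normed_vector +
  assumes norm_solid: "\<bar>x\<bar> \<le> \<bar>y\<bar> \<Longrightarrow> norm x \<le> norm y"

text \<open>Order completeness is the library's conditional completeness. For positive
  elements, disjointness \<open>inf \<bar>x\<bar> \<bar>y\<bar> = 0\<close> reads \<open>inf x y = 0\<close>; since every
  such set is bounded below by 0, being bounded above amounts to order boundedness.\<close>

class universally_complete_vector_lattice = vector_lattice + conditionally_complete_lattice +
  assumes disjoint_bdd_above:
    "(\<And>x. x \<in> A \<Longrightarrow> 0 \<le> x) \<Longrightarrow>
     (\<And>x y. x \<in> A \<Longrightarrow> y \<in> A \<Longrightarrow> x \<noteq> y \<Longrightarrow> inf x y = 0) \<Longrightarrow> bdd_above A"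

definition upward_directed :: "'a::order set \<Rightarrow> bool" where
  "upward_directed D \<longleftrightarrow> D \<noteq> {} \<and> (\<forall>x\<in>D. \<forall>y\<in>D. \<exists>z\<in>D. x \<le> z \<and> y \<le> z)"

definition order_bounded :: "'a::order set \<Rightarrow> bool" where
  "order_bounded A \<longleftrightarrow> (\<exists>a b. A \<subseteq> {a..b})"

definition vector_sublattice :: "'a::vector_lattice set \<Rightarrow> bool" where
  "vector_sublattice E \<longleftrightarrow>
     subspace E \<and> (\<forall>x\<in>E. \<forall>y\<in>E. sup x y \<in> E \<and> inf x y \<in> E)"

definition order_dense :: "'a::vector_lattice set \<Rightarrow> bool" where
  "order_dense E \<longleftrightarrow> (\<forall>g>0. \<exists>e\<in>E. 0 < e \<and> e \<le> g)"

definition lattice_embedding :: "('a::vector_lattice \<Rightarrow> 'b::vector_lattice) \<Rightarrow> bool" where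
  "lattice_embedding j \<longleftrightarrow>
     linear j \<and> inj j \<and>
     (\<forall>x y. j (sup x y) = sup (j x) (j y)) \<and> (\<forall>x y. j (inf x y) = inf (j x) (j y))"

text \<open>The universal completion \<open>F\<^sup>u\<close> of \<open>F\<close> is represented by a universally complete
  vector lattice, given as a type, together with the embedding \<open>j\<close> of \<open>F\<close>
  into it.\<close>

definition universal_completion ::
    "('a::vector_lattice \<Rightarrow> 'u::universally_complete_vector_lattice) \<Rightarrow> bool" where
  "universal_completion j \<longleftrightarrow>
     lattice_embedding j \<and> vector_sublattice (range j) \<and> order_dense (range j)"

definition dominable ::
    "('a::vector_lattice \<Rightarrow> 'u::universally_complete_vector_lattice) \<Rightarrow> 'a set \<Rightarrow> bool" where
  "dominable j A \<longleftrightarrow> order_bounded (j ` A)"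

definition pos_unit_ball :: "'a::normed_lattice set" where
  "pos_unit_ball = cball 0 1 \<inter> {x. 0 \<le> x}"

definition monotonically_bounded :: "'a::normed_lattice itself \<Rightarrow> bool" where
  "monotonically_bounded _ \<longleftrightarrow>
     (\<forall>D :: 'a set. D \<subseteq> pos_unit_ball \<and> upward_directed D \<longrightarrow> order_bounded D)"

definition r_monotonically_bounded :: "real \<Rightarrow> 'a::normed_lattice itself \<Rightarrow> bool" where
  "r_monotonically_bounded r _ \<longleftrightarrow>
     (\<forall>D :: 'a set. D \<subseteq> pos_unit_ball \<and> upward_directed D \<longrightarrow>
        (\<exists>u \<in> (*\<^sub>R) r ` cball 0 1. \<forall>d\<in>D. d \<le> u))"

end

theory Submission
  imports Defs
begin

text \<open>
  If for every \<open>k\<close> some directed set \<open>D\<^sub>k\<close> in the positive unit ball has no upper bound of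
  norm at most \<open>4\<^sup>k\<close>, then the finite sums of elements \<open>2\<^sup>-\<^sup>k\<^sup>-\<^sup>1 d\<^sub>k\<close> form one directed set in
  the ball, and an upper bound \<open>u\<close> of it yields the upper bounds \<open>2\<^sup>k\<^sup>+\<^sup>1 u\<close> of the \<open>D\<^sub>k\<close>, which
  are eventually too small. So monotone boundedness is automatically uniform.

  A directed set \<open>D\<close> in the ball that is not dominable is infinite on the band of some \<open>x > 0\<close>:
  otherwise local bounds on a maximal disjoint family glue in \<open>F\<^sup>u\<close> to a bound of \<open>D\<close>. On that
  band every \<open>0 < y \<le> x\<close> splits, since some \<open>d \<in> D\<close> exceeds a large multiple \<open>N y\<close> on part
  of \<open>y\<close>, but not on all of it because of its norm. This gives disjoint positive \<open>a\<^sub>n\<close> in the band with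
  norm at least \<open>n\<close>. They have a common upper bound \<open>f\<close> in \<open>F\<^sup>u\<close>, and condition (iii) for the
  dominable set of all \<open>y \<ge> 0\<close> below both \<open>f\<close> and an element of \<open>D\<close> provides an upper
  bound in \<open>F\<close> of all \<open>a\<^sub>n\<close>, which is impossible.
\<close>

section \<open>Maximal families and disjointness in vector lattices\<close>

text \<open>Zorn's lemma, with maximality in the form in which it is applied: an element of
  \<open>G\<close> compatible with all of \<open>Z\<close> already lies in \<open>Z\<close>. Both
  orders of \<open>R\<close> occur since \<open>R\<close> may be asymmetric.\<close>

lemma exists_maximal_pairwise:
  obtains Z where "Z \<subseteq> G" "pairwise R Z"
    "\<And>e. e \<in> G \<Longrightarrow> (\<And>z. z \<in> Z \<Longrightarrow> R e z \<and> R z e) \<Longrightarrow> e \<in> Z"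
proof -
  let ?S = "{Z. Z \<subseteq> G \<and> pairwise R Z}"
  have "\<exists>M\<in>?S. \<forall>X\<in>?S. M \<subseteq> X \<longrightarrow> X = M"
  proof (rule subset_Zorn_nonempty)
    show "?S \<noteq> {}" by (auto intro!: exI[of _ "{}"])
    fix C assume C: "C \<noteq> {}" "subset.chain ?S C"
    then have "chain\<^sub>\<subseteq> C" by (auto simp: subset_chain_def chain_subset_def)
    moreover have "\<And>X. X \<in> C \<Longrightarrow> pairwise R X" "\<Union>C \<subseteq> G"
      using C by (auto simp: subset_chain_def)
    ultimately show "\<Union>C \<in> ?S"
      by (auto intro: pairwise_chain_Union)
  qed
  then obtain M where M: "M \<in> ?S" "\<forall>X\<in>?S. M \<subseteq> X \<longrightarrow> X = M" by (rule bexE)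
  show thesis
  proof (rule that)
    show "M \<subseteq> G" "pairwise R M" using M(1) by auto
    fix e assume "e \<in> G" "\<And>z. z \<in> M \<Longrightarrow> R e z \<and> R z e"
    then have "insert e M \<in> ?S" using M(1) by (auto simp: pairwise_insert)
    then have "insert e M = M" using M(2) by (meson subset_insertI)
    then show "e \<in> M" by blast
  qed
qed

text \<open>The arguments are phrased in terms of the differences \<open>a - inf a b\<close>, the positive
  parts of \<open>a - b\<close>, which these default rules would rewrite into suprema.\<close>

declare neg_inf_eq_sup [simp del] diff_inf_eq_sup [simp del]

lemma diff_inf_pos:
  fixes a b :: "'a::vector_lattice"
  assumes "\<not> a \<le> b"
  shows "0 < a - inf a b" "0 < a - inf b a"
proof -
  have "inf a b < a" using assms by (metis inf_le1 inf_le2 order_less_le)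
  then show "0 < a - inf a b" by (simp only: diff_gt_0_iff_gt)
  then show "0 < a - inf b a" by (simp only: inf_commute)
qed

text \<open>The two differences are the positive and the negative part of \<open>a - b\<close>;
  infima commute with translation by \<open>- inf a b\<close>.\<close>

lemma inf_diff_inf_eq_0:
  fixes a b :: "'a::vector_lattice"
  shows "inf (a - inf a b) (b - inf a b) = 0"
  using add_inf_distrib_right[of a b "- inf a b", symmetric]
  by (simp only: diff_conv_add_uminus[symmetric] diff_self)

lemma disjoint_mono:
  fixes a b c d :: "'a::vector_lattice"
  assumes "inf a b = 0" "0 \<le> c" "c \<le> a" "0 \<le> d" "d \<le> b"
  shows "inf c d = 0"
proof (rule antisym)
  show "inf c d \<le> 0" using inf_mono[OF assms(3,5)] assms(1) by simp
  show "0 \<le> inf c d" using assms by simp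
qed

lemma disjoint_scaleR:
  fixes a b :: "'a::vector_lattice"
  assumes "inf a b = 0" "0 \<le> t"
  shows "inf (t *\<^sub>R a) b = 0"
proof -
  have ab: "0 \<le> a" "0 \<le> b" using assms(1) by (metis inf_le1, metis inf_le2)
  \<comment> \<open>Enlarging the factor to \<open>s\<close> gives \<open>inverse s \<le> 1\<close>
    besides \<open>t \<le> s\<close>, so \<open>inverse s *\<^sub>R c\<close> lies below both
    \<open>a\<close> and \<open>b\<close>.\<close>
  define s where "s = max 1 t"
  have s: "1 \<le> s" "t \<le> s" by (auto simp: s_def)
  define c where "c = inf (t *\<^sub>R a) b"
  have c: "0 \<le> c" "c \<le> t *\<^sub>R a" "c \<le> b"
    using ab assms(2) by (auto simp: c_def intro: scaleR_nonneg_nonneg)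
  have "c \<le> s *\<^sub>R a"
    using c(2) scaleR_right_mono[OF s(2) ab(1)] by (rule order_trans)
  then have "inverse s *\<^sub>R c \<le> inverse s *\<^sub>R (s *\<^sub>R a)"
    using s by (intro scaleR_left_mono) auto
  then have 1: "inverse s *\<^sub>R c \<le> a" using s by simp
  have "inverse s *\<^sub>R c \<le> 1 *\<^sub>R c"
    using s c(1) by (intro scaleR_right_mono) (auto simp: inverse_le_1_iff)
  then have "inverse s *\<^sub>R c \<le> b" using c(3) by auto
  with 1 have "inverse s *\<^sub>R c \<le> 0" using assms(1) by (metis le_inf_iff)
  then have "s *\<^sub>R (inverse s *\<^sub>R c) \<le> s *\<^sub>R 0"
    using s by (intro scaleR_left_mono) auto
  then have "c \<le> 0" using s by simp
  with c(1) show ?thesis unfolding c_def[symmetric] by (rule antisym[rotated])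
qed

lemma disjoint_add_le:
  fixes a b c :: "'a::vector_lattice"
  assumes "inf a b = 0" "a \<le> c" "b \<le> c"
  shows "a + b \<le> c"
proof -
  have "a + b = sup a b" using add_eq_inf_sup[of a b] assms(1) by (simp only: add_0_right)
  then show ?thesis using assms(2,3) by (simp only: le_sup_iff)
qed

text \<open>For \<open>c = inf (Sup A) b\<close>, each \<open>a\<close> in \<open>A\<close> is
  disjoint from \<open>c\<close>, so \<open>a + c\<close> is their supremum and stays below
  \<open>Sup A\<close>. Thus \<open>Sup A - c\<close> is again an upper bound, which forces
  \<open>c = 0\<close>.\<close>

lemma disjoint_cSup:
  fixes A :: "'a::{vector_lattice,conditionally_complete_lattice} set"
  assumes "bdd_above A" "A \<noteq> {}" "\<And>a. a \<in> A \<Longrightarrow> inf a b = 0"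
  shows "inf (Sup A) b = 0"
proof -
  have nn: "0 \<le> a" "0 \<le> b" "a \<le> Sup A" if "a \<in> A" for a
    using assms(3)[OF that] cSup_upper[OF that assms(1)] by (metis inf_le1, metis inf_le2, simp)
  obtain a0 where a0: "a0 \<in> A" using assms(2) by blast
  define c where "c = inf (Sup A) b"
  have c0: "0 \<le> c" using nn[OF a0] by (auto simp: c_def intro: order_trans)
  have "Sup A \<le> Sup A - c"
  proof (rule cSup_least[OF assms(2)])
    fix a assume a: "a \<in> A"
    have "inf a c = 0" 
      by (rule disjoint_mono[OF assms(3)[OF a]]) (use nn[OF a] c0 in \<open>auto simp: c_def\<close>)
    then have "a + c \<le> Sup A"
      by (rule disjoint_add_le) (use nn[OF a] in \<open>auto simp: c_def\<close>)
    then show "a \<le> Sup A - c" by (simp add: le_diff_eq)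
  qed
  then have "c \<le> 0" by (simp only: le_diff_eq add_le_same_cancel1)
  then show ?thesis using c0 unfolding c_def[symmetric] by (rule antisym)
qed

lemma lattice_embedding_le_iff:
  assumes "lattice_embedding j"
  shows "j x \<le> j y \<longleftrightarrow> x \<le> y"
proof -
  have "j (inf x y) = inf (j x) (j y)" "inj j" using assms by (simp_all add: lattice_embedding_def)
  then show ?thesis by (metis inf.absorb_iff1 inj_eq)
qed

lemma norm_le_norm_of_nonneg_le:
  fixes x y :: "'a::normed_lattice"
  assumes "0 \<le> x" "x \<le> y"
  shows "norm x \<le> norm y"
  using assms by (intro norm_solid) (simp add: abs_of_nonneg order_trans[OF assms])

section \<open>Uniformity of monotone boundedness\<close>

lemma r_monotonically_bounded_imp_monotonically_bounded:
  assumes "r_monotonically_bounded r TYPE('f::normed_lattice)"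
  shows "monotonically_bounded TYPE('f)"
  unfolding monotonically_bounded_def
proof (intro allI impI)
  fix D :: "'f set"
  assume D: "D \<subseteq> pos_unit_ball \<and> upward_directed D"
  then obtain u where "\<forall>d\<in>D. d \<le> u"
    using assms unfolding r_monotonically_bounded_def by blast
  then have "D \<subseteq> {0..u}" using D by (auto simp: pos_unit_ball_def)
  then show "order_bounded D" by (auto simp: order_bounded_def)
qed

lemma monotonically_bounded_imp_r_monotonically_bounded:
  assumes mb: "monotonically_bounded TYPE('f::normed_lattice)"
  shows "\<exists>r\<ge>1. r_monotonically_bounded r TYPE('f)"
proof (rule ccontr)
  assume neg: "\<not> ?thesis"
  \<comment> \<open>The radii \<open>4 ^ k\<close> outgrow the factors \<open>2 ^ Suc k\<close> that
    undo the weights below.\<close>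
  have "\<exists>D :: 'f set. D \<subseteq> pos_unit_ball \<and> upward_directed D \<and>
      \<not> (\<exists>u \<in> (*\<^sub>R) (4 ^ k) ` cball 0 1. \<forall>d\<in>D. d \<le> u)" for k :: nat
  proof -
    have "\<not> r_monotonically_bounded (4 ^ k) TYPE('f)"
      using neg by (metis one_le_numeral one_le_power)
    then show ?thesis by (auto simp: r_monotonically_bounded_def)
  qed
  then obtain D :: "nat \<Rightarrow> 'f set" where D: "\<And>k. D k \<subseteq> pos_unit_ball" "\<And>k. upward_directed (D k)"
    "\<And>k. \<not> (\<exists>u \<in> (*\<^sub>R) (4 ^ k) ` cball 0 1. \<forall>d\<in>D k. d \<le> u)"
    by metis
  \<comment> \<open>The weights sum to less than 1, which keeps the sums in the ball. Partial sums
    are taken because series need not converge in an incomplete norm.\<close>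
  define s where "s = (\<lambda>n (d :: nat \<Rightarrow> 'f). \<Sum>k<n. (1/2) ^ Suc k *\<^sub>R d k)"
  define E where "E = {s n d | n d. \<forall>k. d k \<in> D k}"
  have D1: "0 \<le> x" "norm x \<le> 1" if "x \<in> D k" for x k
    using D(1)[of k] that by (auto simp: pos_unit_ball_def)
  have ne: "\<exists>d. d \<in> D k" for k
    using D(2)[of k] by (auto simp: upward_directed_def)
  have s_mono: "s m c \<le> s n d" if "m \<le> n" "\<And>k. c k \<le> d k" "\<And>k. 0 \<le> d k" for m n c d
  proof -
    have "s m c \<le> s m d"
      unfolding s_def using that by (intro sum_mono scaleR_left_mono) auto
    also have "\<dots> \<le> s n d"
      unfolding s_def using that by (intro sum_mono2 scaleR_nonneg_nonneg) auto
    finally show ?thesis .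
  qed
  have "E \<subseteq> pos_unit_ball"
  proof
    fix x assume "x \<in> E"
    then obtain n d where x: "x = s n d" and d: "\<And>k. d k \<in> D k" by (auto simp: E_def)
    have "0 \<le> x"
      unfolding x s_def using D1[OF d] by (intro sum_nonneg scaleR_nonneg_nonneg) auto
    have "norm x \<le> (\<Sum>k<n. (1/2) ^ Suc k)"
      unfolding x s_def using D1[OF d] by (intro sum_norm_le) (auto simp: mult_left_le)
    also have "\<dots> = 1 - (1/2) ^ n" by (induction n) auto
    finally have "norm x \<le> 1" using zero_le_power[of "1/2 :: real" n] by linarith
    with \<open>0 \<le> x\<close> show "x \<in> pos_unit_ball" by (simp add: pos_unit_ball_def)
  qed
  moreover have "upward_directed E"
    unfolding upward_directed_def
  proof (intro conjI ballI)
    show "E \<noteq> {}" 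
    proof -
      obtain d where "\<forall>k. d k \<in> D k" using ne by metis
      then show ?thesis by (auto simp: E_def)
    qed
    fix x y assume "x \<in> E" "y \<in> E"
    then obtain m c n d where x: "x = s m c" "\<And>k. c k \<in> D k" and y: "y = s n d" "\<And>k. d k \<in> D k" 
      by (auto simp: E_def)
    have "\<forall>k. \<exists>e\<in>D k. c k \<le> e \<and> d k \<le> e"
      using D(2) x(2) y(2) by (auto simp: upward_directed_def)
    then obtain e where e: "\<And>k. e k \<in> D k" "\<And>k. c k \<le> e k" "\<And>k. d k \<le> e k" by metis
    have "s (max m n) e \<in> E" using e(1) by (auto simp: E_def)
    moreover have "x \<le> s (max m n) e" "y \<le> s (max m n) e"
      unfolding x(1) y(1) using e D1[OF e(1)] by (auto intro!: s_mono)
    ultimately show "\<exists>z\<in>E. x \<le> z \<and> y \<le> z" by blast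
  qed
  ultimately have "order_bounded E"
    using mb unfolding monotonically_bounded_def by blast
  then obtain u where u: "\<And>x. x \<in> E \<Longrightarrow> x \<le> u"
    unfolding order_bounded_def by (metis atLeastAtMost_iff subsetD)
  have le: "x \<le> 2 ^ Suc k *\<^sub>R u" if x: "x \<in> D k" for x k
  proof -
    obtain d where d: "\<And>i. d i \<in> D i" using ne by metis
    have d': "\<And>i. (d(k := x)) i \<in> D i" using d x by auto
    have "0 \<le> (\<Sum>i<k. (1/2) ^ Suc i *\<^sub>R (d(k := x)) i)"
      using D1(1)[OF d'] by (intro sum_nonneg scaleR_nonneg_nonneg) (simp_all del: fun_upd_apply)
    then have "(1/2) ^ Suc k *\<^sub>R x \<le> s (Suc k) (d(k := x))"
      unfolding s_def by (simp add: add_increasing)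
    also have "\<dots> \<le> u" by (rule u) (use d' in \<open>unfold E_def, blast\<close>)
    finally have "2 ^ Suc k *\<^sub>R ((1/2) ^ Suc k *\<^sub>R x) \<le> 2 ^ Suc k *\<^sub>R u"
      by (intro scaleR_left_mono) auto
    then show ?thesis by (simp add: power_one_over)
  qed
  \<comment> \<open>With this \<open>k\<close>, the upper bound \<open>2 ^ Suc k *\<^sub>R u\<close>
    of \<open>D k\<close> has norm at most \<open>4 ^ k\<close>.\<close>
  obtain k where k: "2 * norm u \<le> 2 ^ k"
    by (metis less_imp_le one_less_numeral_iff real_arch_pow semiring_norm(76))
  define v where "v = inverse (4 ^ k) *\<^sub>R (2 ^ Suc k *\<^sub>R u)"
  have "4 ^ k = (2 ^ k * 2 ^ k :: real)" by (simp flip: power_mult_distrib)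
  then have "norm v = 2 * norm u / 2 ^ k" by (simp add: v_def field_simps)
  also have "\<dots> \<le> 1" using k by (simp add: field_simps)
  finally have "v \<in> cball 0 1" by simp
  moreover have "4 ^ k *\<^sub>R v = 2 ^ Suc k *\<^sub>R u" by (simp add: v_def)
  ultimately have "2 ^ Suc k *\<^sub>R u \<in> (*\<^sub>R) (4 ^ k) ` cball 0 1" by (metis imageI)
  with D(3)[of k] le show False by blast
qed

section \<open>Local bounds and dominability\<close>

text \<open>The last condition in \<open>loc\<close> says that \<open>u\<close> bounds
  \<open>D\<close> on the band of \<open>z\<close>, since \<open>d - inf d u\<close> is the excess
  of \<open>d\<close> over \<open>u\<close>. Local bounds on a maximal disjoint family become
  disjoint after projection to the bands, hence have a common bound \<open>h\<close> in the
  universal completion. An excess of some \<open>j d\<close> over \<open>h\<close> would put all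
  multiples of a nonzero \<open>w\<close> below \<open>d\<close>, contradicting the norm.\<close>

lemma dominable_if_locally_bounded:
  fixes j :: "'f::normed_lattice \<Rightarrow> 'u::universally_complete_vector_lattice"
  assumes uc: "universal_completion j"
    and nonneg: "\<And>d. d \<in> D \<Longrightarrow> 0 \<le> d"
    and loc: "\<And>x. 0 < x \<Longrightarrow>
      \<exists>z u. 0 < z \<and> z \<le> x \<and> 0 \<le> u \<and> (\<forall>d\<in>D. inf (d - inf d u) z = 0)"
  shows "dominable j D"
proof -
  have emb: "lattice_embedding j" and dense: "order_dense (range j)"
    using uc by (auto simp: universal_completion_def)
  interpret j: linear j using emb by (simp add: lattice_embedding_def)
  have j_inf: "j (inf x y) = inf (j x) (j y)" for x y
    using emb by (simp add: lattice_embedding_def)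
  note j_le = lattice_embedding_le_iff[OF emb]
  define G where "G = {z. 0 < z \<and> (\<exists>u\<ge>0. \<forall>d\<in>D. inf (d - inf d u) z = 0)}"
  obtain Z where Z: "Z \<subseteq> G" "pairwise (\<lambda>x y. inf x y = 0) Z"
    "\<And>e. e \<in> G \<Longrightarrow> (\<And>z. z \<in> Z \<Longrightarrow> inf e z = 0 \<and> inf z e = 0) \<Longrightarrow> e \<in> Z"
    using exists_maximal_pairwise[of G "\<lambda>x y. inf x y = 0"] by metis
  have "\<forall>z\<in>Z. \<exists>u\<ge>0. \<forall>d\<in>D. inf (d - inf d u) z = 0"
    using Z(1) by (auto simp: G_def)
  then obtain U where "\<forall>z\<in>Z. 0 \<le> U z \<and> (\<forall>d\<in>D. inf (d - inf d (U z)) z = 0)"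
    by (rule bchoice[THEN exE])
  then have U: "\<And>z. z \<in> Z \<Longrightarrow> 0 \<le> U z"
    "\<And>z d. z \<in> Z \<Longrightarrow> d \<in> D \<Longrightarrow> inf (d - inf d (U z)) z = 0" by simp_all
  have Zpos: "0 < z" if "z \<in> Z" for z using Z(1) that by (auto simp: G_def)
  \<comment> \<open>For \<open>z\<close> in \<open>Z\<close>, \<open>Sup (T z)\<close> is the
    component of \<open>j (U z)\<close> in the band generated by \<open>j z\<close>.\<close>
  define T where "T z = range (\<lambda>n. j (inf (real n *\<^sub>R z) (U z)))" for z
  have T_bdd: "bdd_above (T z)" for z
    by (rule bdd_aboveI[of _ "j (U z)"]) (auto simp: T_def j_le)
  have T_upper: "j (inf (real n *\<^sub>R z) (U z)) \<le> Sup (T z)" for n z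
    by (rule cSup_upper[OF _ T_bdd]) (auto simp: T_def)
  have T_disj: "inf (Sup (T z)) (Sup (T z')) = 0" if z: "z \<in> Z" "z' \<in> Z" "z \<noteq> z'" for z z'
  proof (rule disjoint_cSup[OF T_bdd])
    show "T z \<noteq> {}" by (simp add: T_def)
    fix a assume "a \<in> T z"
    then obtain n where a: "a = j (inf (real n *\<^sub>R z) (U z))" by (auto simp: T_def)
    have "inf (Sup (T z')) a = 0"
    proof (rule disjoint_cSup[OF T_bdd])
      show "T z' \<noteq> {}" by (simp add: T_def)
      fix b assume "b \<in> T z'"
      then obtain m where b: "b = j (inf (real m *\<^sub>R z') (U z'))" by (auto simp: T_def)
      have "inf z' z = 0" using Z(2) z by (auto simp: pairwise_def)
      then have "inf (real m *\<^sub>R z') z = 0" by (rule disjoint_scaleR) simp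
      then have "inf z (real m *\<^sub>R z') = 0" by (simp add: inf_commute)
      then have "inf (real n *\<^sub>R z) (real m *\<^sub>R z') = 0" by (rule disjoint_scaleR) simp
      then have "inf (inf (real n *\<^sub>R z) (U z)) (inf (real m *\<^sub>R z') (U z')) = 0"
        by (rule disjoint_mono)
          (use U(1) z Zpos in \<open>auto intro!: scaleR_nonneg_nonneg simp: less_imp_le\<close>)
      then have "inf a b = 0" unfolding a b by (simp flip: j_inf)
      then show "inf b a = 0" by (simp add: inf_commute)
    qed
    then show "inf a (Sup (T z')) = 0" by (simp add: inf_commute)
  qed
  have "0 \<le> Sup (T z)" if "z \<in> Z" for z
    using T_upper[of 0 z] U(1)[OF that] by (simp add: inf_absorb1)
  then have "bdd_above ((\<lambda>z. Sup (T z)) ` Z)"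
    using T_disj by (intro disjoint_bdd_above) auto
  then obtain h where h: "\<And>z. z \<in> Z \<Longrightarrow> Sup (T z) \<le> h"
    by (auto simp: bdd_above_def)
  have "j d \<le> h" if d: "d \<in> D" for d
  proof (rule ccontr)
    assume "\<not> j d \<le> h"
    then have "0 < j d - inf (j d) h" by (rule diff_inf_pos)
    \<comment> \<open>Order density brings the excess of \<open>j d\<close> over \<open>h\<close>
      back to a positive element of \<open>F\<close>.\<close>
    then obtain e' where "e' \<in> range j" "0 < e'" "e' \<le> j d - inf (j d) h"
      using dense unfolding order_dense_def by blast
    then obtain e where e0: "0 < j e" and e: "j e \<le> j d - inf (j d) h" by auto
    have "0 < e" using e0 j_le[of 0 e] j_le[of e 0] by (auto simp: less_le_not_le j.zero)
    obtain z u where z: "0 < z" "z \<le> e" "0 \<le> u" "\<forall>d\<in>D. inf (d - inf d u) z = 0"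
      using loc[OF \<open>0 < e\<close>] by blast
    \<comment> \<open>Otherwise the \<open>z\<close> found below \<open>e\<close> would be disjoint
      from \<open>Z\<close>, hence in \<open>Z\<close> by maximality, hence disjoint from
      itself.\<close>
    have "\<exists>z\<in>Z. inf e z \<noteq> 0"
    proof (rule ccontr)
      assume *: "\<not> ?thesis"
      have dj: "inf z z' = 0" if "z' \<in> Z" for z'
        by (rule disjoint_mono[of e z'])
          (use * that z Zpos[OF that] in \<open>auto simp: less_imp_le\<close>)
      have "z \<in> Z" by (rule Z(3)) (use z dj in \<open>auto simp: G_def inf_commute[of _ z]\<close>)
      then show False using dj z(1) by fastforce
    qed
    then obtain z where z: "z \<in> Z" "inf e z \<noteq> 0" by blast
    define w where "w = inf e z"
    have w: "0 \<le> w" "w \<noteq> 0" "w \<le> z" "w \<le> e"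
      using z Zpos[OF z(1)] \<open>0 < e\<close> by (auto simp: w_def less_imp_le)
    \<comment> \<open>On the band of \<open>z\<close>, \<open>d\<close> stays below
      \<open>U z\<close>, so the image of the truncation \<open>c\<close> lies below
      \<open>inf (j d) h\<close>, while \<open>j w\<close> lies below the complementary part of
      \<open>j d\<close>.\<close>
    have step: "w + inf d (real n *\<^sub>R z) \<le> d" for n
    proof -
      define c where "c = inf d (real n *\<^sub>R z)"
      have "inf z (d - inf d (U z)) = 0"
        using U(2)[OF z(1) d] by (simp add: inf_commute)
      then have 0: "inf (real n *\<^sub>R z) (d - inf d (U z)) = 0"
        by (rule disjoint_scaleR) simp
      have c0: "0 \<le> c" using nonneg[OF d] Zpos[OF z(1)]
        by (auto simp: c_def less_imp_le intro!: scaleR_nonneg_nonneg)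
      have "c - inf d (U z) \<le> real n *\<^sub>R z"
        using U(1)[OF z(1)] nonneg[OF d] unfolding c_def
        by (metis add_increasing2 diff_le_eq inf_le2 le_inf_iff)
      moreover have "c - inf d (U z) \<le> d - inf d (U z)" by (simp add: c_def)
      ultimately have "c - inf d (U z) \<le> 0" using 0 by (metis le_inf_iff)
      then have "c \<le> inf (real n *\<^sub>R z) (U z)" by (simp add: c_def)
      then have "j c \<le> h"
        using T_upper[of n z] h[OF z(1)] j_le by (meson order_trans)
      moreover have "j c \<le> j d" by (simp add: j_le c_def)
      ultimately have "j c \<le> inf (j d) h" by simp
      moreover have "j w \<le> j d - inf (j d) h" using e w(4) j_le by (meson order_trans)
      ultimately have "j w + j c \<le> j d" by (metis add_mono diff_add_cancel)
      then show ?thesis by (simp add: c_def j_le flip: j.add)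
    qed
    have nw: "real n *\<^sub>R w \<le> d" for n
    proof (induction n)
      case 0
      then show ?case using nonneg[OF d] by simp
    next
      case (Suc n)
      have "real n *\<^sub>R w \<le> real n *\<^sub>R z" using w by (intro scaleR_left_mono) auto
      with Suc have "w + real n *\<^sub>R w \<le> w + inf d (real n *\<^sub>R z)" by simp
      also have "\<dots> \<le> d" by (rule step)
      finally show ?case by (simp add: scaleR_add_left)
    qed
    have "real n * norm w \<le> norm d" for n
      using norm_le_norm_of_nonneg_le[OF scaleR_nonneg_nonneg[OF _ w(1)] nw, of n] by simp
    moreover have "0 < norm w" using w by simp
    ultimately show False by (meson not_le reals_Archimedean3)
  qed
  moreover have "0 \<le> j d" if "d \<in> D" for d
    using nonneg[OF that] j_le[of 0 d] by (simp add: j.zero)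
  ultimately show ?thesis
    unfolding dominable_def order_bounded_def by (intro exI[of _ 0] exI[of _ h]) auto
qed

text \<open>The conclusion makes \<open>t *\<^sub>R y\<close> the supremum of its truncations
  \<open>inf d (t *\<^sub>R y)\<close>, so \<open>D\<close> is infinite on the band of
  \<open>x\<close>. If every \<open>x\<close> violated this, each violation would give a local
  bound, and \<open>D\<close> would be dominable.\<close>

lemma exists_ray_exhausted_if_not_dominable:
  fixes j :: "'f::normed_lattice \<Rightarrow> 'u::universally_complete_vector_lattice"
  assumes uc: "universal_completion j"
    and nonneg: "\<And>d. d \<in> D \<Longrightarrow> 0 \<le> d"
    and not_dom: "\<not> dominable j D"
  obtains x where "0 < x"
    "\<And>y t u. 0 < y \<Longrightarrow> y \<le> x \<Longrightarrow> 1 \<le> t \<Longrightarrow> (\<And>d. d \<in> D \<Longrightarrow> inf d (t *\<^sub>R y) \<le> u) \<Longrightarrow> t *\<^sub>R y \<le> u"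
proof -
  have "D \<noteq> {}"
    using not_dom by (auto simp: dominable_def order_bounded_def)
  then obtain d0 where d0: "d0 \<in> D" by blast
  have "\<exists>x>0. \<forall>y t u. 0 < y \<longrightarrow> y \<le> x \<longrightarrow> 1 \<le> t \<longrightarrow> (\<forall>d\<in>D. inf d (t *\<^sub>R y) \<le> u) \<longrightarrow> t *\<^sub>R y \<le> u"
  proof (rule ccontr)
    assume neg: "\<not> ?thesis"
    have "dominable j D"
    proof (rule dominable_if_locally_bounded[OF uc nonneg])
      fix x :: 'f assume "0 < x"
      then obtain y t u where y: "0 < y" "y \<le> x" "1 \<le> t" "\<And>d. d \<in> D \<Longrightarrow> inf d (t *\<^sub>R y) \<le> u"
        "\<not> t *\<^sub>R y \<le> u" using neg by blast
      define v where "v = inf u (t *\<^sub>R y)"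
      have ty: "0 \<le> t *\<^sub>R y" using y by (intro scaleR_nonneg_nonneg) auto
      have dv: "inf d (t *\<^sub>R y) \<le> v" if "d \<in> D" for d using y(4)[OF that] by (simp add: v_def)
      have v0: "0 \<le> v"
        using nonneg[OF d0] ty dv[OF d0] by (meson le_infI order_trans)
      have pos: "0 < t *\<^sub>R y - v" unfolding v_def using y(5) by (rule diff_inf_pos)
      \<comment> \<open>Up to scaling, \<open>z\<close> is the part of \<open>t *\<^sub>R y\<close>
        left uncovered by the truncations of \<open>D\<close>.\<close>
      define z where "z = inverse t *\<^sub>R (t *\<^sub>R y - v)"
      have z0: "0 < z" unfolding z_def using y(3) pos by (simp add: order_less_le scaleR_nonneg_nonneg)
      have "z \<le> inverse t *\<^sub>R (t *\<^sub>R y)"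
        unfolding z_def using y(3) v0 by (intro scaleR_left_mono) auto
      then have "z \<le> x" using y by simp
      moreover have "inf (d - inf d v) z = 0" if d: "d \<in> D" for d
      proof -
        \<comment> \<open>Hence \<open>d\<close> exceeds \<open>v\<close> only by what it exceeds
          \<open>t *\<^sub>R y\<close>, and that excess is disjoint from
          \<open>t *\<^sub>R y - v\<close>.\<close>
        have eq: "inf d v = inf d (t *\<^sub>R y)"
          by (rule antisym) (use dv[OF d] in \<open>auto simp: v_def intro: le_infI2\<close>)
        have le: "inf d (t *\<^sub>R y) \<le> d" "v \<le> t *\<^sub>R y" by (simp_all add: v_def)
        have "inf (t *\<^sub>R y - inf d (t *\<^sub>R y)) (d - inf d (t *\<^sub>R y)) = 0"
          using inf_diff_inf_eq_0[of d "t *\<^sub>R y"] by (simp add: inf_commute)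
        then have "inf (t *\<^sub>R y - v) (d - inf d v) = 0"
          by (rule disjoint_mono)
            (use le dv[OF d] in \<open>simp_all only: eq diff_ge_0_iff_ge diff_left_mono order_refl\<close>)
        then have "inf z (d - inf d v) = 0"
          unfolding z_def by (rule disjoint_scaleR) (use y(3) in auto)
        then show ?thesis by (simp add: inf_commute)
      qed
      ultimately show "\<exists>z u. 0 < z \<and> z \<le> x \<and> 0 \<le> u \<and> (\<forall>d\<in>D. inf (d - inf d u) z = 0)"
        using z0 v0 by blast
    qed
    with not_dom show False by blast
  qed
  then show thesis using that by blast
qed

section \<open>Disjoint elements of large norm\<close>

text \<open>One piece of each splitting becomes a term and the other is split again. All later terms
  lie below the latter, so they are disjoint from the former.\<close>

lemma exists_disjoint_sequence:
  fixes x :: "'a::vector_lattice"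
  assumes "0 < x"
    and split: "\<And>y. 0 < y \<Longrightarrow> y \<le> x \<Longrightarrow> \<exists>v w. 0 < v \<and> v \<le> y \<and> 0 < w \<and> w \<le> y \<and> inf v w = 0"
  obtains w :: "nat \<Rightarrow> 'a"
  where "\<And>n. 0 < w n" "\<And>n. w n \<le> x" "\<And>m n. m \<noteq> n \<Longrightarrow> inf (w m) (w n) = 0"
proof -
  obtain V W where VW: "\<And>y. 0 < y \<Longrightarrow> y \<le> x \<Longrightarrow>
      0 < V y \<and> V y \<le> y \<and> 0 < W y \<and> W y \<le> y \<and> inf (V y) (W y) = 0"
    using split by metis
  define y where "y n = (V ^^ n) x" for n
  have y: "0 < y n \<and> y n \<le> x" for n
    by (induction n) (use assms(1) VW in \<open>auto simp: y_def intro: order_trans\<close>)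
  have V: "0 < V (y n)" "V (y n) \<le> y n" and W: "0 < W (y n)" "W (y n) \<le> y n"
    and VW_disj: "inf (V (y n)) (W (y n)) = 0" for n
    using VW[of "y n"] y[of n] by simp_all
  have y_Suc: "y (Suc n) = V (y n)" for n by (simp add: y_def)
  have "decseq y" by (rule decseq_SucI) (simp only: y_Suc V)
  have lt: "inf (W (y m)) (W (y n)) = 0" if "m < n" for m n
  proof (rule disjoint_mono)
    show "inf (W (y m)) (y (Suc m)) = 0" using VW_disj[of m] by (simp only: y_Suc inf_commute)
    have "y n \<le> y (Suc m)" using \<open>decseq y\<close> that by (simp add: decseq_def)
    with W(2)[of n] show "W (y n) \<le> y (Suc m)" by (rule order_trans)
    show "0 \<le> W (y m)" "0 \<le> W (y n)" by (rule less_imp_le, rule W)+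
  qed simp
  show thesis
  proof (rule that)
    show "0 < W (y n)" for n by (rule W)
    show "W (y n) \<le> x" for n using W(2)[of n] y[of n] by (elim conjE) (rule order_trans)
    show "inf (W (y m)) (W (y n)) = 0" if "m \<noteq> n" for m n
      using that lt[of m n] lt[of n m] by (auto simp: inf_commute neq_iff)
  qed
qed

lemma monotonically_bounded_if_dominable_order_bounded:
  fixes j :: "'f::normed_lattice \<Rightarrow> 'u::universally_complete_vector_lattice"
  assumes uc: "universal_completion j"
    and dom: "\<And>D :: 'f set. D \<subseteq> pos_unit_ball \<Longrightarrow> upward_directed D \<Longrightarrow> dominable j D \<Longrightarrow> order_bounded D"
  shows "monotonically_bounded TYPE('f)"
  unfolding monotonically_bounded_def
proof (intro allI impI, elim conjE)
  fix D :: "'f set"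
  assume D: "D \<subseteq> pos_unit_ball" "upward_directed D"
  have D1: "0 \<le> d" "norm d \<le> 1" if "d \<in> D" for d
    using D(1) that by (auto simp: pos_unit_ball_def)
  have emb: "lattice_embedding j"
    using uc by (auto simp: universal_completion_def)
  interpret j: linear j using emb by (simp add: lattice_embedding_def)
  have j_inf: "j (inf x y) = inf (j x) (j y)" and j_sup: "j (sup x y) = sup (j x) (j y)" for x y
    using emb by (simp_all add: lattice_embedding_def)
  note j_le = lattice_embedding_le_iff[OF emb]
  show "order_bounded D"
  proof (cases "dominable j D")
    case True
    then show ?thesis using dom D by blast
  next
    case False
    from exists_ray_exhausted_if_not_dominable[OF uc D1(1) False]
    obtain x where x: "0 < x" and exh: "\<And>y t u. 0 < y \<Longrightarrow> y \<le> x \<Longrightarrow> 1 \<le> t \<Longrightarrow>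
        (\<And>d. d \<in> D \<Longrightarrow> inf d (t *\<^sub>R y) \<le> u) \<Longrightarrow> t *\<^sub>R y \<le> u" by metis
    have split: "\<exists>v w. 0 < v \<and> v \<le> y \<and> 0 < w \<and> w \<le> y \<and> inf v w = 0" if y: "0 < y" "y \<le> x" for y
    proof -
      \<comment> \<open>Since \<open>N * norm y\<close> exceeds 1, no element of \<open>D\<close>
        dominates \<open>N *\<^sub>R y\<close>.\<close>
      define N where "N = 1 + 1 / norm y"
      have ny: "0 < norm y" using y by auto
      then have N: "1 \<le> N" "1 < N * norm y" by (auto simp: N_def field_simps)
      have Ny: "0 \<le> N *\<^sub>R y" using N y by (intro scaleR_nonneg_nonneg) auto
      have NNy: "(2 * N) *\<^sub>R y = N *\<^sub>R y + N *\<^sub>R y" by (metis mult_2 scaleR_add_left)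
      have "\<not> (2 * N) *\<^sub>R y \<le> N *\<^sub>R y"
      proof
        assume "(2 * N) *\<^sub>R y \<le> N *\<^sub>R y"
        then have "N *\<^sub>R y \<le> 0" by (simp add: NNy)
        then have "N *\<^sub>R y = 0" using Ny by simp
        then show False using N y by auto
      qed
      then obtain d where d: "d \<in> D" "\<not> inf d ((2 * N) *\<^sub>R y) \<le> N *\<^sub>R y"
        using exh[OF y, of "2 * N" "N *\<^sub>R y"] N by fastforce
      \<comment> \<open>Truncation at \<open>2 * N\<close> keeps the excess \<open>m - p\<close>
        over \<open>N *\<^sub>R y\<close> below \<open>N *\<^sub>R y\<close>. The deficit
        \<open>N *\<^sub>R y - p\<close> is disjoint from it, and dividing both by \<open>N\<close>
        splits \<open>y\<close>.\<close>
      define m where "m = inf d ((2 * N) *\<^sub>R y)"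
      define p where "p = inf m (N *\<^sub>R y)"
      have m0: "0 \<le> m" using D1(1)[OF d(1)] Ny by (simp add: m_def NNy)
      then have p0: "0 \<le> p" using Ny by (simp add: p_def)
      have vpos: "0 < m - p"
        unfolding p_def by (rule diff_inf_pos) (use d(2) in \<open>simp add: m_def\<close>)
      have "\<not> N *\<^sub>R y \<le> m"
      proof
        assume "N *\<^sub>R y \<le> m"
        then have "N *\<^sub>R y \<le> d" by (simp add: m_def)
        then have "N * norm y \<le> 1"
          using norm_le_norm_of_nonneg_le[OF Ny] D1(2)[OF d(1)] N(1) by fastforce
        then show False using N by simp
      qed
      then have wpos: "0 < N *\<^sub>R y - p" unfolding p_def by (rule diff_inf_pos)
      have "m - N *\<^sub>R y \<le> p"
        unfolding p_def
      proof (rule le_infI)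
        show "m - N *\<^sub>R y \<le> m" using Ny by simp
        have "m \<le> N *\<^sub>R y + N *\<^sub>R y" unfolding m_def NNy by (rule inf_le2)
        then show "m - N *\<^sub>R y \<le> N *\<^sub>R y" by (simp only: diff_le_eq)
      qed
      then have vle: "m - p \<le> N *\<^sub>R y" by (simp add: algebra_simps)
      have wle: "N *\<^sub>R y - p \<le> N *\<^sub>R y" using p0 by simp
      have scale: "0 < inverse N *\<^sub>R a \<and> inverse N *\<^sub>R a \<le> y" if "0 < a" "a \<le> N *\<^sub>R y" for a
      proof -
        have "inverse N *\<^sub>R a \<le> inverse N *\<^sub>R (N *\<^sub>R y)"
          using that N by (intro scaleR_left_mono) auto
        then show ?thesis using that N by (auto simp: order_less_le scaleR_nonneg_nonneg)
      qed
      have "inf (m - p) (N *\<^sub>R y - p) = 0" unfolding p_def by (rule inf_diff_inf_eq_0)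
      then have "inf (inverse N *\<^sub>R (m - p)) (N *\<^sub>R y - p) = 0"
        by (rule disjoint_scaleR) (use N in auto)
      then have "inf (N *\<^sub>R y - p) (inverse N *\<^sub>R (m - p)) = 0" by (simp add: inf_commute)
      then have "inf (inverse N *\<^sub>R (N *\<^sub>R y - p)) (inverse N *\<^sub>R (m - p)) = 0"
        by (rule disjoint_scaleR) (use N in auto)
      then show ?thesis using scale[OF vpos vle] scale[OF wpos wle] by blast
    qed
    obtain w :: "nat \<Rightarrow> 'f" where w: "\<And>n. 0 < w n" "\<And>n. w n \<le> x"
      "\<And>m n. m \<noteq> n \<Longrightarrow> inf (w m) (w n) = 0"
      using exists_disjoint_sequence[OF x split] by blast
    \<comment> \<open>The summand 1 ensures \<open>1 \<le> t n\<close>, as \<open>exh\<close>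
      requires; the other gives \<open>a n\<close> norm at least \<open>n\<close>.\<close>
    define t where "t n = 1 + real n / norm (w n)" for n
    define a where "a n = t n *\<^sub>R w n" for n
    have t1: "1 \<le> t n" for n by (simp add: t_def)
    have a0: "0 \<le> a n" for n
      unfolding a_def using t1[of n] w(1)[of n] by (intro scaleR_nonneg_nonneg) auto
    have norm_a: "real n \<le> norm (a n)" for n
    proof -
      have "0 < norm (w n)" using w(1)[of n] by auto
      then show ?thesis using t1[of n] by (simp add: a_def t_def field_simps)
    qed
    have a_disj: "inf (a m) (a n) = 0" if "m \<noteq> n" for m n
    proof -
      have "inf (a m) (w n) = 0"
        unfolding a_def by (rule disjoint_scaleR[OF w(3)[OF that]]) (use t1[of m] in auto)
      then have "inf (w n) (a m) = 0" by (simp add: inf_commute)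
      then have "inf (a n) (a m) = 0"
        unfolding a_def[of n] by (rule disjoint_scaleR) (use t1[of n] in auto)
      then show ?thesis by (simp add: inf_commute)
    qed
    have "bdd_above (range (\<lambda>n. j (a n)))"
    proof (rule disjoint_bdd_above)
      show "0 \<le> b" if "b \<in> range (\<lambda>n. j (a n))" for b
        using that a0 j_le[of 0] by (auto simp: j.zero)
      show "inf b c = 0" if bc: "b \<in> range (\<lambda>n. j (a n))" "c \<in> range (\<lambda>n. j (a n))" "b \<noteq> c" for b c
      proof -
        obtain m n where "b = j (a m)" "c = j (a n)" "m \<noteq> n" using bc by blast
        then show ?thesis using a_disj[of m n] by (simp add: j.zero flip: j_inf)
      qed
    qed
    then obtain f where f: "\<And>n. j (a n) \<le> f" by (auto simp: bdd_above_def)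
    have f0: "0 \<le> f" using f[of 0] a0[of 0] j_le[of 0 "a 0"] by (simp add: j.zero)
    \<comment> \<open>The bound \<open>f\<close> makes \<open>E\<close> dominable, and
      \<open>D\<close> keeps it directed and inside the ball.\<close>
    define E where "E = {y. 0 \<le> y \<and> j y \<le> f \<and> (\<exists>d\<in>D. y \<le> d)}"
    have "E \<subseteq> pos_unit_ball"
      using norm_le_norm_of_nonneg_le D1(2) by (fastforce simp: E_def pos_unit_ball_def)
    moreover have "upward_directed E"
      unfolding upward_directed_def
    proof (intro conjI ballI)
      have "0 \<in> E" using D(2) f0 D1(1) by (auto simp: E_def j.zero upward_directed_def)
      then show "E \<noteq> {}" by blast
      fix y z assume yz: "y \<in> E" "z \<in> E"
      then obtain d d' where "d \<in> D" "d' \<in> D" "y \<le> d" "z \<le> d'" by (auto simp: E_def)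
      moreover from this obtain d'' where "d'' \<in> D" "d \<le> d''" "d' \<le> d''"
        using D(2) by (auto simp: upward_directed_def)
      ultimately have "sup y z \<in> E"
        using yz by (auto simp: E_def j_sup intro: le_supI1 order_trans)
      then show "\<exists>v\<in>E. y \<le> v \<and> z \<le> v" by (meson sup_ge1 sup_ge2)
    qed
    moreover have "dominable j E"
      unfolding dominable_def order_bounded_def using j_le[of 0]
      by (intro exI[of _ 0] exI[of _ f]) (auto simp: E_def j.zero)
    ultimately have "order_bounded E" by (rule dom)
    then obtain u where u: "\<And>y. y \<in> E \<Longrightarrow> y \<le> u" 
      unfolding order_bounded_def by (metis atLeastAtMost_iff subsetD)
    \<comment> \<open>All truncations \<open>inf d (a n)\<close> lie in \<open>E\<close>, so
      \<open>u\<close> bounds them and, by exhaustion, \<open>a n\<close> itself.\<close>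
    have "a n \<le> u" for n
      unfolding a_def
    proof (rule exh[OF w(1,2) t1])
      fix d assume d: "d \<in> D"
      have "j (inf d (a n)) \<le> f" using f[of n] by (auto simp: j_inf intro: le_infI2)
      then have "inf d (a n) \<in> E" using d D1(1)[OF d] a0 by (auto simp: E_def intro!: bexI[of _ d])
      then show "inf d (t n *\<^sub>R w n) \<le> u" using u by (simp add: a_def)
    qed
    then have "real n \<le> norm u" for n
      using norm_a[of n] norm_le_norm_of_nonneg_le[OF a0, of n u] by (meson order_trans)
    then show ?thesis by (meson not_le reals_Archimedean2)
  qed
qed

theorem theorem5p1:
  fixes j :: "'f::normed_lattice \<Rightarrow> 'u::universally_complete_vector_lattice"
  assumes "universal_completion j"
  shows "(monotonically_bounded TYPE('f) \<longleftrightarrow>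
            (\<exists>r\<ge>1. r_monotonically_bounded r TYPE('f)))
       \<and> ((\<exists>r\<ge>1. r_monotonically_bounded r TYPE('f)) \<longleftrightarrow>
            (\<forall>D :: 'f set. D \<subseteq> pos_unit_ball \<and> upward_directed D \<and> dominable j D
               \<longrightarrow> order_bounded D))"
proof -
  have "monotonically_bounded TYPE('f) \<longleftrightarrow> (\<exists>r\<ge>1. r_monotonically_bounded r TYPE('f))"
    using monotonically_bounded_imp_r_monotonically_bounded
      r_monotonically_bounded_imp_monotonically_bounded by blast
  moreover have "monotonically_bounded TYPE('f) \<longleftrightarrow>
      (\<forall>D :: 'f set. D \<subseteq> pos_unit_ball \<and> upward_directed D \<and> dominable j D \<longrightarrow> order_bounded D)"
    using monotonically_bounded_if_dominable_order_bounded[OF assms]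
    unfolding monotonically_bounded_def by blast
  ultimately show ?thesis by blast
qed

end
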